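(* Let $b\geq 2$ and $k\in\mathbb{Z}^+$. If there exists a $k$-oasis base $b$, then there exists a $k$-mirage base $b$.
   Context: For integers $c\geq 0$ and $b\geq 2$, the augmented generalized happy function $S_{[c,b]}:\mathbb{Z}^+\to\mathbb{Z}^+$ is defined by $S_{[c,b]}\left(\sum_{i=0}^n a_i b^i\right)=c+\sum_{i=0}^n a_i^2$, where $0\le a_i\le b-1$, $a_n\neq 0$ (the base $b$ expansion); additionally $S_{[0,b]}(0)=0$. A positive integer $a$ is a fixed point of $S_{[c,b]}$ if $S_{[c,b]}(a)=a$. A $k$-oasis base $b$ is a set of $k$ consecutive non-negative integers $c$ such that for each of them $S_{[c,b]}$ has at least one fixed point. A $k$-mirage base $b$ is a set of $k$ consecutive integers $\{d_1,\dots,d_k\}$ such that for each $1\le i\le k$, $d_i=r_i-S_{[0,b]}(r_i)$ for some non-negative integer $r_i$ having at most three base $b$ digits (i.e., $0\le r_i<b^3$). *)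

theory Defs
  imports Main
begin

text \<open>Base \<open>b\<close> digits of \<open>n\<close>, least significant first and without leading zeros.
  Only meaningful for \<open>b \<ge> 2\<close>; the guard on \<open>b\<close> makes the recursion total.\<close>

function base_digits :: "nat \<Rightarrow> nat \<Rightarrow> nat list" where
  "base_digits b n =
    (if b < 2 \<or> n = 0 then [] else n mod b # base_digits b (n div b))"
  by pat_completeness auto
termination
  by (relation "measure snd") auto

declare base_digits.simps [simp del]

text \<open>The augmented generalized happy function. At \<open>n = 0\<close> the digit list is empty, so the
  value is \<open>c\<close>; for \<open>c = 0\<close> this is the convention that \<open>0\<close> is mapped to \<open>0\<close>.\<close>

definition happy :: "nat \<Rightarrow> nat \<Rightarrow> nat \<Rightarrow> nat" where
  "happy c b n = c + (\<Sum>a\<leftarrow>base_digits b n. a\<^sup>2)"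

definition happy_fixed_point :: "nat \<Rightarrow> nat \<Rightarrow> nat \<Rightarrow> bool" where
  "happy_fixed_point c b a \<longleftrightarrow> a > 0 \<and> happy c b a = a"

definition oasis :: "nat \<Rightarrow> nat \<Rightarrow> nat set \<Rightarrow> bool" where
  "oasis k b C \<longleftrightarrow>
    (\<exists>m. C = {m..<m + k}) \<and> (\<forall>c\<in>C. \<exists>a. happy_fixed_point c b a)"

text \<open>The elements of a mirage are integers and may be negative. The bound \<open>r < b ^ 3\<close>
  says that \<open>r\<close> has at most three base \<open>b\<close> digits.\<close>

definition mirage :: "nat \<Rightarrow> nat \<Rightarrow> int set \<Rightarrow> bool" where
  "mirage k b D \<longleftrightarrow>
    (\<exists>m. D = {m..<m + int k}) \<and>
    (\<forall>d\<in>D. \<exists>r<b ^ 3. d = int r - int (happy 0 b r))"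

lemma base_digits_expansion:
  assumes "b \<ge> 2" "\<forall>a\<in>set ds. a < b" "ds \<noteq> [] \<Longrightarrow> last ds \<noteq> 0"
  shows "base_digits b (horner_sum id b ds) = ds"
  using assms(2,3)
proof (induction ds)
  case Nil
  then show ?case by (simp add: base_digits.simps)
next
  case (Cons a ds)
  have a: "a < b" using Cons.prems by simp
  have IH: "base_digits b (horner_sum id b ds) = ds"
    by (rule Cons.IH) (use Cons.prems in auto)
  have "a + b * horner_sum id b ds \<noteq> 0"
  proof (cases "ds = []")
    case True
    then show ?thesis using Cons.prems by simp
  next
    case False
    then have "horner_sum id b ds \<noteq> 0"
      using IH by (metis base_digits.simps)
    then show ?thesis using assms(1) by simp
  qed
  then show ?case
    using a IH assms(1) by (subst base_digits.simps) auto
qed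

text \<open>The defining equation in terms of the base \<open>b\<close> expansion \<open>\<Sum>i\<le>n. a i * b ^ i\<close>.\<close>

lemma happy_expansion:
  assumes "b \<ge> 2" "\<And>i. i \<le> n \<Longrightarrow> a i < b" "a n \<noteq> 0"
  shows "happy c b (\<Sum>i\<le>n. a i * b ^ i) = c + (\<Sum>i\<le>n. (a i)\<^sup>2)"
proof -
  let ?ds = "map a [0..<Suc n]"
  have "(\<Sum>i\<le>n. a i * b ^ i) = horner_sum id b ?ds"
    by (simp add: horner_sum_eq_sum atLeast0LessThan lessThan_Suc_atMost del: upt_Suc sum.op_ivl_Suc)
  moreover have "base_digits b (horner_sum id b ?ds) = ?ds"
    by (rule base_digits_expansion) (use assms in auto)
  moreover have "(\<Sum>x\<leftarrow>?ds. x\<^sup>2) = (\<Sum>i\<le>n. (a i)\<^sup>2)"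
    by (simp add: interv_sum_list_conv_sum_set_nat comp_def atLeast0LessThan
        lessThan_Suc_atMost del: upt_Suc)
  ultimately show ?thesis
    by (simp add: happy_def del: upt_Suc)
qed

end

theory Submission
  imports Defs
begin

text \<open>Put \<open>g a = a - S\<^bsub>[0,b]\<^esub>(a)\<close>; a fixed point \<open>a\<close> for \<open>c\<close> satisfies \<open>g a = c\<close>. Split
  \<open>a = h * b ^ 3 + r\<close> with \<open>r < b ^ 3\<close>, so that \<open>g a = (h * b ^ 3 - S h) + g r\<close>. Increasing \<open>h\<close>
  by one increases the first summand by at least \<open>b ^ 3 - 2 * b + 3\<close>, whereas \<open>g r\<close> varies
  within a range of length at most \<open>b ^ 3 - 3/4 * b\<^sup>2 - b + 1\<close>. Values of \<open>g\<close> with different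
  high parts are therefore never consecutive, so \<open>h\<close> is constant along an oasis,
  and subtracting \<open>h * b ^ 3 - S h\<close> from it gives a mirage.\<close>

definition happy_defect :: "nat \<Rightarrow> nat \<Rightarrow> int" where
  "happy_defect b a = int a - int (happy 0 b a)"

lemma happy_eq_add: "happy c b a = c + happy 0 b a"
  by (simp add: happy_def)

text \<open>A zero digit contributes nothing, so the recursion also holds at
  \<open>b * q + d = 0\<close>, where the digit list is empty.\<close>

lemma happy_0_digit:
  assumes "b \<ge> 2" "d < b"
  shows "happy 0 b (b * q + d) = happy 0 b q + d\<^sup>2"
proof (cases "b * q + d = 0")
  case True
  then show ?thesis using assms by (auto simp: happy_def)
next
  case False
  then show ?thesis
    using assms by (subst happy_def, subst base_digits.simps) (auto simp: happy_def)
qed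

text \<open>Without a carry the last digit \<open>d\<close> satisfies \<open>d + 2 <= b\<close>, and
  its square grows by \<open>2 * d + 1 <= 2 * b - 3\<close>. With a carry the last digit drops to 0,
  and induction bounds the growth coming from the remaining digits.\<close>

lemma happy_0_Suc:
  assumes "b \<ge> 2"
  shows "happy 0 b (Suc q) + 3 \<le> happy 0 b q + 2 * b"
proof (induction q rule: less_induct)
  case (less q)
  define p d where "p = q div b" and "d = q mod b"
  have d: "d < b" and q: "q = b * p + d"
    using assms by (auto simp: p_def d_def)
  show ?case
  proof (cases "Suc d < b")
    case True
    have "happy 0 b (Suc q) = happy 0 b p + (Suc d)\<^sup>2"
      using happy_0_digit [OF assms True, of p] by (simp add: q)
    moreover have "happy 0 b q = happy 0 b p + d\<^sup>2"
      using happy_0_digit [OF assms d, of p] by (simp add: q)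
    ultimately show ?thesis
      using True by (simp add: power2_eq_square)
  next
    case False
    then have b: "b = Suc d" using d by simp
    then have "Suc q = b * Suc p + 0" by (simp add: q)
    then have "happy 0 b (Suc q) = happy 0 b (Suc p)"
      using happy_0_digit [OF assms, of 0 "Suc p"] assms by simp
    moreover have "happy 0 b q = happy 0 b p + d\<^sup>2"
      using happy_0_digit [OF assms d, of p] by (simp add: q)
    moreover have "p < q" using b assms by (simp add: q)
    ultimately show ?thesis
      using less.IH [of p] by simp
  qed
qed

text \<open>Zeros padding \<open>r\<close> to \<open>n\<close> digits do not affect the sum of
  squares, so cutting off the low \<open>n\<close> digits splits it.\<close>

lemma happy_0_split:
  assumes "b \<ge> 2" "r < b ^ n"
  shows "happy 0 b (h * b ^ n + r) = happy 0 b h + happy 0 b r"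
  using assms(2)
proof (induction n arbitrary: r)
  case 0
  then show ?case by (simp add: happy_def base_digits.simps)
next
  case (Suc n)
  define q d where "q = r div b" and "d = r mod b"
  have d: "d < b" and r: "r = b * q + d"
    using assms(1) by (auto simp: q_def d_def)
  have "q < b ^ n"
    using Suc.prems by (simp add: q_def less_mult_imp_div_less mult.commute)
  then have "happy 0 b (h * b ^ n + q) = happy 0 b h + happy 0 b q"
    by (rule Suc.IH)
  moreover have "h * b ^ Suc n + r = b * (h * b ^ n + q) + d"
    by (simp add: r algebra_simps)
  ultimately show ?case
    using happy_0_digit [OF assms(1) d, of "h * b ^ n + q"] happy_0_digit [OF assms(1) d, of q]
    by (simp only: r add.assoc)
qed

text \<open>The first two summands together are \<open>h * b ^ n - happy 0 b h\<close>, the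
  contribution of the high part.\<close>

lemma happy_defect_split:
  assumes "b \<ge> 2" "r < b ^ n"
  shows "happy_defect b (h * b ^ n + r) =
    happy_defect b h + int h * (int b ^ n - 1) + happy_defect b r"
  using happy_0_split [OF assms, of h] by (simp add: happy_defect_def algebra_simps)

text \<open>In terms of the digits \<open>z\<close>, \<open>y\<close>, \<open>x\<close> of
  \<open>r\<close>, the defect is \<open>z * (b ^ 2 - z) + y * (b - y) - x * (x - 1)\<close>, and
  each summand is bounded separately. The factor 4 clears the denominator of the bound
  \<open>b ^ 2 / 4\<close> for the middle one.\<close>

lemma happy_defect_bounds:
  assumes "b \<ge> 2" "r < b ^ 3"
  shows "- ((int b - 1) * (int b - 2)) \<le> happy_defect b r"
    and "4 * happy_defect b r \<le> (int b)\<^sup>2 + 4 * ((int b - 1) * ((int b)\<^sup>2 - int b + 1))"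
proof -
  define q x y z where "q = r div b" and "x = r mod b" and "y = q mod b" and "z = q div b"
  have xy: "x < b" "y < b" and r: "r = b * q + x" and q: "q = b * z + y"
    using assms(1) by (auto simp: q_def x_def y_def z_def)
  have z: "z < b"
    using assms(2) by (simp add: q_def z_def less_mult_imp_div_less power3_eq_cube)
  have "happy 0 b z = z\<^sup>2"
    using happy_0_digit [OF assms(1) z, of 0] by (simp add: happy_def base_digits.simps)
  then have "happy 0 b r = z\<^sup>2 + y\<^sup>2 + x\<^sup>2"
    using happy_0_digit [OF assms(1) xy(1), of q] happy_0_digit [OF assms(1) xy(2), of z]
    by (simp add: r q)
  then have f: "happy_defect b r =
      int z * ((int b)\<^sup>2 - int z) + int y * (int b - int y) - int x * (int x - 1)"
    unfolding happy_defect_def by (simp add: r q power2_eq_square algebra_simps)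
  have sq: "int b \<le> (int b)\<^sup>2"
    using assms(1) by (simp add: power2_eq_square)
  have y0: "0 \<le> int y * (int b - int y)"
    using xy by simp
  have y1: "4 * (int y * (int b - int y)) \<le> (int b)\<^sup>2"
    using zero_le_power2 [of "int b - 2 * int y"] by (simp add: power2_eq_square algebra_simps)
  have z0: "0 \<le> int z * ((int b)\<^sup>2 - int z)"
    using z sq by simp
  have z1: "int z * ((int b)\<^sup>2 - int z) \<le> (int b - 1) * ((int b)\<^sup>2 - int b + 1)"
  proof -
    \<comment> \<open>This product is exactly the right side minus the left side of the
      claim.\<close>
    have "0 \<le> (int b - 1 - int z) * ((int b)\<^sup>2 - int b + 1 - int z)"
    proof (rule mult_nonneg_nonneg)
      have "2 * int b \<le> (int b)\<^sup>2"
        using assms(1) by (simp add: power2_eq_square)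
      then show "0 \<le> (int b)\<^sup>2 - int b + 1 - int z" using z by linarith
    qed (use z in simp)
    then show ?thesis by (simp add: power2_eq_square algebra_simps)
  qed
  have x0: "0 \<le> int x * (int x - 1)"
    by (cases x) auto
  have x1: "int x * (int x - 1) \<le> (int b - 1) * (int b - 2)"
  proof (cases "x = 0")
    case True
    then show ?thesis using assms(1) by simp
  next
    case False
    then show ?thesis using xy by (intro mult_mono) auto
  qed
  show "- ((int b - 1) * (int b - 2)) \<le> happy_defect b r"
    using f y0 z0 x1 by linarith
  show "4 * happy_defect b r \<le> (int b)\<^sup>2 + 4 * ((int b - 1) * ((int b)\<^sup>2 - int b + 1))"
    using f y1 z1 x0 by linarith
qed

lemma happy_defect_gap:
  assumes b: "b \<ge> 2" and "a div b ^ 3 < a' div b ^ 3"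
  shows "happy_defect b a + 1 < happy_defect b a'"
proof -
  define F where "F h = happy_defect b h + int h * (int b ^ 3 - 1)" for h
  have split: "happy_defect b n = F (n div b ^ 3) + happy_defect b (n mod b ^ 3)" for n
    using happy_defect_split [OF b, of "n mod b ^ 3" 3 "n div b ^ 3"] b
    unfolding F_def div_mult_mod_eq by simp
  have step: "F h + (int b ^ 3 - 2 * int b + 3) \<le> F (Suc h)" for h
    using happy_0_Suc [OF b, of h] by (simp add: F_def happy_defect_def algebra_simps)
  have pos: "0 \<le> int b ^ 3 - 2 * int b + 3"
  proof -
    have "2 * int b \<le> int b * int b" using b by simp
    also have "\<dots> * 1 \<le> int b * int b * int b" using b by (intro mult_left_mono) auto
    finally show ?thesis by (simp add: power3_eq_cube)
  qed
  have mono: "F i \<le> F j" if "i \<le> j" for i j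
    by (rule lift_Suc_mono_le [OF _ that]) (use step pos in \<open>smt (verit)\<close>)
  define r r' where "r = a mod b ^ 3" and "r' = a' mod b ^ 3"
  have r: "r < b ^ 3" "r' < b ^ 3" using b by (simp_all add: r_def r'_def)
  have "F (a div b ^ 3) + (int b ^ 3 - 2 * int b + 3) \<le> F (a' div b ^ 3)"
    using step [of "a div b ^ 3"] mono [of "Suc (a div b ^ 3)" "a' div b ^ 3"] assms(2) by linarith
  \<comment> \<open>The cubes cancel; after multiplication by 4 it remains to see
    \<open>4 * b < 3 * b ^ 2 + 4\<close>, which follows from \<open>2 * b <= b ^ 2\<close>.\<close>
  moreover have "happy_defect b r + 1 < happy_defect b r' + (int b ^ 3 - 2 * int b + 3)"
  proof -
    have "2 * int b \<le> (int b)\<^sup>2" using b by (simp add: power2_eq_square)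
    moreover have "4 * happy_defect b r + 7 * (int b)\<^sup>2 + 4 \<le> 8 * int b + 4 * int b ^ 3"
      using happy_defect_bounds(2) [OF b r(1)]
      by (simp add: power2_eq_square power3_eq_cube algebra_simps)
    moreover have "3 * int b \<le> 2 + happy_defect b r' + (int b)\<^sup>2"
      using happy_defect_bounds(1) [OF b r(2)] by (simp add: power2_eq_square algebra_simps)
    ultimately show ?thesis using b by linarith
  qed
  ultimately show ?thesis
    unfolding split [of a] split [of a'] r_def r'_def by linarith
qed

theorem theorem10:
  fixes b k :: nat
  assumes "b \<ge> 2" and "k \<ge> 1"
    and "\<exists>C. oasis k b C"
  shows "\<exists>D. mirage k b D"
proof -
  obtain m where "\<forall>c\<in>{m..<m + k}. \<exists>a. happy_fixed_point c b a"
    using assms(3) by (auto simp: oasis_def)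
  then obtain a where "happy_fixed_point c b (a c)" if "c \<in> {m..<m + k}" for c
    by metis
  then have a: "happy_defect b (a (m + i)) = int (m + i)" if "i < k" for i
    using that happy_eq_add [of "m + i" b "a (m + i)"]
    by (force simp: happy_fixed_point_def happy_defect_def)
  define h where "h = a m div b ^ 3"
  have h: "a (m + i) div b ^ 3 = h" if "i < k" for i
    using that
  proof (induction i)
    case 0
    then show ?case by (simp add: h_def)
  next
    case (Suc i)
    have "happy_defect b (a (m + Suc i)) = happy_defect b (a (m + i)) + 1"
      using a [of i] a [of "Suc i"] Suc.prems by simp
    \<comment> \<open>A larger high part would raise the defect by more than 1, and a smaller one
      would lower it.\<close>
    then have "a (m + Suc i) div b ^ 3 = a (m + i) div b ^ 3"
      using happy_defect_gap [OF assms(1), of "a (m + i)" "a (m + Suc i)"]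
        happy_defect_gap [OF assms(1), of "a (m + Suc i)" "a (m + i)"] by linarith
    then show ?case using Suc by simp
  qed
  define s where "s = int m - (happy_defect b h + int h * (int b ^ 3 - 1))"
  have "\<exists>r<b ^ 3. d = int r - int (happy 0 b r)" if "d \<in> {s..<s + int k}" for d
  proof -
    define i where "i = nat (d - s)"
    have i: "i < k" "d = s + int i" using that by (auto simp: i_def)
    \<comment> \<open>The witness is formed by the low three digits of the fixed point for
      \<open>m + i\<close>.\<close>
    define r where "r = a (m + i) mod b ^ 3"
    have r: "r < b ^ 3" using assms(1) by (simp add: r_def)
    have "a (m + i) = h * b ^ 3 + r"
      unfolding r_def h [OF i(1), symmetric] by (rule div_mult_mod_eq [symmetric])
    then have "happy_defect b r = d"
      using a [OF i(1)] happy_defect_split [OF assms(1) r, of h] by (simp add: s_def i(2))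
    then show ?thesis using r by (auto simp: happy_defect_def)
  qed
  then have "mirage k b {s..<s + int k}"
    by (auto simp: mirage_def)
  then show ?thesis ..
qed

end
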